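(* Let $A_1,\dots,A_m\in S^n$ be given, and let $$r^*=\max\left\{\mathrm{rank}\Big(\sum_{i=1}^m t_iA_i\Big):\ \sum_{i=1}^m t_iA_i\succeq 0,\ t_i\in R,\ i=1,\dots,m\right\}.$$ Consider the system $$(\ast)\qquad \langle A_i,X\rangle=0,\quad i=1,\dots,m,\qquad X\succeq 0.$$ (i) The system $(\ast)$ has a solution $X\ne 0$ if and only if $r^*\le n-1$. Moreover, any nonzero solution $X$ of $(\ast)$ satisfies $\mathrm{rank}(X)\le n-r^*$. (ii) Particularly, if $r^*=n-1$, then the system $(\ast)$ has a rank-one solution, and the rank-one solutions are the only nonzero solutions of $(\ast)$. In this case, the problem $$\max\{\langle I,X\rangle:\ \langle A_i,X\rangle=0,\ i=1,\dots,m,\ \mathrm{rank}(X)\le 1,\ \mathrm{tr}(X)\le 1,\ X\succeq 0\}$$ is equivalent to the semidefinite programming (SDP) problem $$\max\{\langle I,X\rangle:\ \langle A_i,X\rangle=0,\ i=1,\dots,m,\ \mathrm{tr}(X)\le 1,\ X\succeq 0\}.$$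
   Context: $R$ is the set of real numbers; $S^n$ is the set of real symmetric $n\times n$ matrices; $\langle X,Y\rangle=\mathrm{tr}(X^TY)$ is the trace inner product of $n\times n$ matrices, where $\mathrm{tr}$ denotes the trace; for $X\in S^n$, $X\succeq 0$ means that $X$ is positive semidefinite (so the unknown $X$ ranges over $S^n$); $I$ is the $n\times n$ identity matrix. A rank-one solution is a solution $X$ with $\mathrm{rank}(X)=1$. *)

theory Defs
  imports "HOL-Analysis.Analysis"
begin

definition sym_matrix :: "real^'n^'n \<Rightarrow> bool" where
  "sym_matrix X \<longleftrightarrow> transpose X = X"

text \<open>Positive semidefiniteness is understood for symmetric matrices only, so it includes symmetry.\<close>

definition psd :: "real^'n^'n \<Rightarrow> bool" where
  "psd X \<longleftrightarrow> sym_matrix X \<and> (\<forall>x. 0 \<le> x \<bullet> (X *v x))"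

definition trace_inner :: "real^'n^'n \<Rightarrow> real^'n^'n \<Rightarrow> real" where
  "trace_inner X Y = trace (transpose X ** Y)"

definition lin_comb :: "nat \<Rightarrow> (nat \<Rightarrow> real^'n^'n) \<Rightarrow> (nat \<Rightarrow> real) \<Rightarrow> real^'n^'n" where
  "lin_comb m A t = (\<Sum>i=1..m. t i *\<^sub>R A i)"

text \<open>The set of ranks is nonempty (take \<open>t = 0\<close>) and bounded by \<open>CARD('n)\<close>, so the maximum exists.\<close>

definition max_psd_rank :: "nat \<Rightarrow> (nat \<Rightarrow> real^'n^'n) \<Rightarrow> nat" where
  "max_psd_rank m A = Max {rank (lin_comb m A t) | t. psd (lin_comb m A t)}"

definition is_solution :: "nat \<Rightarrow> (nat \<Rightarrow> real^'n^'n) \<Rightarrow> real^'n^'n \<Rightarrow> bool" where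
  "is_solution m A X \<longleftrightarrow> (\<forall>i\<in>{1..m}. trace_inner (A i) X = 0) \<and> psd X"

definition rank_constrained_feasible :: "nat \<Rightarrow> (nat \<Rightarrow> real^'n^'n) \<Rightarrow> (real^'n^'n) set" where
  "rank_constrained_feasible m A =
     {X. (\<forall>i\<in>{1..m}. trace_inner (A i) X = 0) \<and> rank X \<le> 1 \<and> trace X \<le> 1 \<and> psd X}"

definition sdp_feasible :: "nat \<Rightarrow> (nat \<Rightarrow> real^'n^'n) \<Rightarrow> (real^'n^'n) set" where
  "sdp_feasible m A =
     {X. (\<forall>i\<in>{1..m}. trace_inner (A i) X = 0) \<and> trace X \<le> 1 \<and> psd X}"

definition is_max_value :: "('a \<Rightarrow> real) \<Rightarrow> 'a set \<Rightarrow> real \<Rightarrow> bool" where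
  "is_max_value f F v \<longleftrightarrow> (\<exists>x\<in>F. f x = v) \<and> (\<forall>x\<in>F. f x \<le> v)"

definition maximizers :: "('a \<Rightarrow> real) \<Rightarrow> 'a set \<Rightarrow> 'a set" where
  "maximizers f F = {x. is_arg_max f (\<lambda>x. x \<in> F) x}"

text \<open>
  Equivalence of the problems \<open>max {f x | x \<in> F}\<close> and \<open>max {f x | x \<in> G}\<close> with a common
  objective: the same feasible points, both maxima attained with the same value, and the same
  optimal solutions.
\<close>

definition equivalent_max_problems :: "('a \<Rightarrow> real) \<Rightarrow> 'a set \<Rightarrow> 'a set \<Rightarrow> bool" where
  "equivalent_max_problems f F G \<longleftrightarrow>
     F = G \<and> (\<exists>v. is_max_value f F v \<and> is_max_value f G v) \<and> maximizers f F = maximizers f G"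

end

theory Submission
  imports Defs
begin

text \<open>
  A positive semidefinite matrix is a sum of matrices \<open>v v\<^sup>T\<close> (symmetric Gaussian elimination), so
  positive semidefinite \<open>X\<close> and \<open>Y\<close> with \<open>\<langle>Y, X\<rangle> = 0\<close> satisfy \<open>Y X = 0\<close>. Hence the ranges of a
  solution and of a positive semidefinite combination of the \<open>A i\<close> are orthogonal, which gives
  the rank bound. If there is no nonzero solution, then the orthogonal complement of the span of
  the \<open>A i\<close> misses the compact convex hull of the matrices \<open>v v\<^sup>T\<close>, \<open>norm v = 1\<close>; a separating
  hyperplane has its normal in the span, and this normal is positive definite.
\<close>

section \<open>Trace inner product and the matrices \<open>v v\<^sup>T\<close>\<close>

lemma trace_inner_eq_inner: "trace_inner X Y = X \<bullet> Y"
proof -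
  have "trace_inner X Y = (\<Sum>i\<in>UNIV. \<Sum>j\<in>UNIV. X $ j $ i * Y $ j $ i)"
    by (simp add: trace_inner_def trace_def matrix_matrix_mult_def transpose_def)
  also have "\<dots> = X \<bullet> Y"
    unfolding inner_vec_def by (subst sum.swap) simp
  finally show ?thesis .
qed

lemma trace_inner_mat_1: "trace_inner (mat 1) X = trace X"
  by (simp add: trace_inner_def transpose_mat)

lemma sym_matrix_dot:
  assumes "sym_matrix X"
  shows "x \<bullet> (X *v y) = (X *v x) \<bullet> y"
  using assms by (metis sym_matrix_def dot_lmul_matrix vector_transpose_matrix)

definition outer_square :: "real^'n \<Rightarrow> real^'n^'n" where
  "outer_square v = (\<chi> i j. v $ i * v $ j)"

lemma outer_square_mult_vec: "outer_square v *v x = (v \<bullet> x) *\<^sub>R v"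
  by (simp add: outer_square_def matrix_vector_mult_def vec_eq_iff inner_vec_def
      sum_distrib_left sum_distrib_right mult_ac)

text \<open>Quadratic forms in \<open>v\<close> become linear functionals of
  \<open>outer_square v\<close>. A hyperplane in matrix space can therefore be read as a statement
  about the quadratic form of its normal.\<close>

lemma inner_outer_square: "B \<bullet> outer_square v = v \<bullet> (B *v v)"
  by (simp add: outer_square_def matrix_vector_mult_def inner_vec_def sum_distrib_left mult_ac)

lemma trace_outer_square: "trace (outer_square v) = v \<bullet> v"
  by (simp add: trace_def outer_square_def inner_vec_def)

lemma sym_outer_square: "sym_matrix (outer_square v)"
  by (simp add: sym_matrix_def transpose_def outer_square_def vec_eq_iff mult.commute)

lemma psd_outer_square: "psd (outer_square v)"
  by (simp add: psd_def sym_outer_square outer_square_mult_vec inner_commute)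

lemma matrix_mult_outer_square:
  assumes "Y *v v = 0"
  shows "Y ** outer_square v = 0"
  using assms
  by (simp add: matrix_eq matrix_vector_mul_assoc [symmetric] outer_square_mult_vec
      matrix_vector_mult_scaleR)

section \<open>Quadratic forms of positive semidefinite matrices\<close>

lemma quadratic_form_add_scaleR:
  assumes "sym_matrix X"
  shows "(x + t *\<^sub>R y) \<bullet> (X *v (x + t *\<^sub>R y))
    = x \<bullet> (X *v x) + 2 * t * (x \<bullet> (X *v y)) + t\<^sup>2 * (y \<bullet> (X *v y))"
  using sym_matrix_dot [OF assms, of x y]
  by (simp add: matrix_vector_right_distrib matrix_vector_mult_scaleR inner_simps
      power2_eq_square algebra_simps inner_commute)

lemma psd_Cauchy_Schwarz:
  assumes "psd X" and pos: "0 < y \<bullet> (X *v y)"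
  shows "(x \<bullet> (X *v y))\<^sup>2 / (y \<bullet> (X *v y)) \<le> x \<bullet> (X *v x)"
proof -
  define b c where "b = x \<bullet> (X *v y)" and "c = y \<bullet> (X *v y)"
  \<comment> \<open>The parameter \<open>- b / c\<close> minimizes the form along the line
    \<open>x + t y\<close>.\<close>
  have "0 \<le> (x + (- b / c) *\<^sub>R y) \<bullet> (X *v (x + (- b / c) *\<^sub>R y))"
    using assms(1) unfolding psd_def by blast
  also have "\<dots> = x \<bullet> (X *v x) + 2 * (- b / c) * b + (- b / c)\<^sup>2 * c"
    using assms(1) by (subst quadratic_form_add_scaleR) (auto simp: psd_def b_def c_def)
  also have "\<dots> = x \<bullet> (X *v x) - b\<^sup>2 / c"
    using pos by (simp add: c_def [symmetric] power2_eq_square field_simps)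
  finally show ?thesis
    by (simp add: b_def c_def)
qed

lemma psd_quadratic_form_eq_0:
  assumes "psd X" and "x \<bullet> (X *v x) = 0"
  shows "X *v x = 0"
proof (rule ccontr)
  assume "X *v x \<noteq> 0"
  define y where "y = X *v x"
  have sym: "sym_matrix X" and nonneg: "0 \<le> z \<bullet> (X *v z)" for z
    using assms(1) by (auto simp: psd_def)
  have b: "x \<bullet> (X *v y) = y \<bullet> y" and b_pos: "0 < y \<bullet> y"
    using \<open>X *v x \<noteq> 0\<close> sym_matrix_dot [OF sym, of x y] by (simp_all add: y_def)
  show False
  proof (cases "y \<bullet> (X *v y) = 0")
    case True
    \<comment> \<open>With both pure terms zero, the form at \<open>x + t y\<close> is linear in
      \<open>t\<close> with slope \<open>2 * (y \<bullet> y)\<close>, so any negative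
      \<open>t\<close> refutes nonnegativity.\<close>
    then have "0 \<le> 2 * (-1) * (y \<bullet> y)"
      using nonneg [of "x + (-1) *\<^sub>R y"] quadratic_form_add_scaleR [OF sym, of x "-1" y] assms(2) b
      by simp
    then show False
      using b_pos by simp
  next
    case False
    then have pos: "0 < y \<bullet> (X *v y)"
      using nonneg [of y] by linarith
    with psd_Cauchy_Schwarz [OF assms(1) pos, of x] assms(2) b
    have "(y \<bullet> y)\<^sup>2 / (y \<bullet> (X *v y)) \<le> 0"
      by simp
    moreover have "0 < (y \<bullet> y)\<^sup>2 / (y \<bullet> (X *v y))"
      using pos b_pos by simp
    ultimately show False
      by linarith
  qed
qed

text \<open>
  The eliminated vector \<open>v\<close> is column \<open>k\<close> of \<open>X\<close> divided by the square root of the pivot; the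
  remainder \<open>X - v v\<^sup>T\<close> has strictly fewer nonzero columns, which drives the induction.
\<close>

lemma psd_induct [consumes 1, case_names zero add]:
  fixes X :: "real^'n^'n"
  assumes "psd X" and "P 0"
    and add: "\<And>X v. psd X \<Longrightarrow> P X \<Longrightarrow> P (X + outer_square v)"
  shows "P X"
  using assms(1)
proof (induction "card {i. X *v axis i 1 \<noteq> 0}" arbitrary: X rule: less_induct)
  case less
  have sym: "sym_matrix X" and nonneg: "0 \<le> z \<bullet> (X *v z)" for z
    using less.prems by (auto simp: psd_def)
  show ?case
  proof (cases "\<exists>k. X *v axis k 1 \<noteq> 0")
    case False
    then have "X = 0"
      by (simp add: matrix_vector_mult_basis column_def vec_eq_iff)
    then show ?thesis
      using assms(2) by simp
  next
    case True
    then obtain k where k: "X *v axis k 1 \<noteq> 0"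
      by blast
    define e c where "e = (axis k 1 :: real^'n)" and "c = e \<bullet> (X *v e)"
    define v where "v = (1 / sqrt c) *\<^sub>R (X *v e)"
    define X' where "X' = X - outer_square v"
    have c: "0 < c"
      using k nonneg [of e] psd_quadratic_form_eq_0 [OF less.prems, of e]
      unfolding c_def e_def by fastforce
    have X': "X' *v x = X *v x - ((x \<bullet> (X *v e)) / c) *\<^sub>R (X *v e)" for x
      using c by (simp add: X'_def v_def matrix_vector_mult_diff_rdistrib outer_square_mult_vec
          inner_commute)
    have "psd X'"
      unfolding psd_def
    proof (intro conjI allI)
      show "sym_matrix X'"
        using sym sym_outer_square [of v]
        by (simp add: X'_def sym_matrix_def transpose_def vec_eq_iff)
      \<comment> \<open>Cauchy-Schwarz in its divided form says exactly that elimination keeps the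
        form nonnegative.\<close>
      show "0 \<le> x \<bullet> (X' *v x)" for x
        using psd_Cauchy_Schwarz [OF less.prems, of e x] c
        by (simp add: X' inner_simps c_def [symmetric] power2_eq_square)
    qed
    moreover have "card {i. X' *v axis i 1 \<noteq> 0} < card {i. X *v axis i 1 \<noteq> 0}"
    proof (rule psubset_card_mono)
      \<comment> \<open>No zero column is lost, and column \<open>k\<close> becomes a new
        one.\<close>
      have "X' *v x = 0" if "X *v x = 0" for x
        using that by (simp add: X' sym_matrix_dot [OF sym])
      moreover have "X' *v e = 0"
        using c by (simp add: X' c_def [symmetric])
      ultimately show "{i. X' *v axis i 1 \<noteq> 0} \<subset> {i. X *v axis i 1 \<noteq> 0}"
        using k unfolding e_def by blast
    qed simp
    ultimately have "P (X' + outer_square v)"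
      using less.hyps add by blast
    then show ?thesis
      by (simp add: X'_def)
  qed
qed

section \<open>Orthogonality and ranks\<close>

text \<open>By induction \<open>Y \<bullet> X\<close> is a sum of terms
  \<open>v \<bullet> (Y *v v)\<close>, all nonnegative. If the sum vanishes, so does each term, and
  then \<open>Y *v v = 0\<close>. The two claims are proved together because splitting a zero sum
  uses nonnegativity of the partial sum.\<close>

lemma psd_inner_nonneg_and_mult_eq_0:
  assumes "psd X" and "psd Y"
  shows "0 \<le> Y \<bullet> X \<and> (Y \<bullet> X = 0 \<longrightarrow> Y ** X = 0)"
  using assms(1)
proof (induction X rule: psd_induct)
  case zero
  then show ?case
    by (simp add: matrix_eq matrix_vector_mul_assoc [symmetric])
next
  case (add X v)
  have split: "Y \<bullet> (X + outer_square v) = Y \<bullet> X + v \<bullet> (Y *v v)"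
    by (simp add: inner_simps inner_outer_square)
  have nonneg: "0 \<le> v \<bullet> (Y *v v)"
    using assms(2) by (simp add: psd_def)
  show ?case
  proof (intro conjI impI)
    show "0 \<le> Y \<bullet> (X + outer_square v)"
      using add nonneg by (simp add: split)
    assume "Y \<bullet> (X + outer_square v) = 0"
    then have "Y \<bullet> X = 0" "v \<bullet> (Y *v v) = 0"
      using add nonneg unfolding split by linarith+
    then have "Y ** X = 0" "Y ** outer_square v = 0"
      using add psd_quadratic_form_eq_0 [OF assms(2)] matrix_mult_outer_square by blast+
    then show "Y ** (X + outer_square v) = 0"
      by (simp add: matrix_add_ldistrib)
  qed
qed

text \<open>Moving the symmetric \<open>Y\<close> across the inner product shows that the column
  spaces of \<open>X\<close> and \<open>Y\<close> are orthogonal, so their dimensions add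
  up.\<close>

lemma rank_add_le_if_mult_eq_0:
  fixes X Y :: "real^'n^'n"
  assumes "sym_matrix Y" and "Y ** X = 0"
  shows "rank X + rank Y \<le> CARD('n)"
proof -
  have "orthogonal (X *v x) (Y *v y)" for x y
    using sym_matrix_dot [OF assms(1), of "X *v x" y] assms(2)
    by (simp add: orthogonal_def matrix_vector_mul_assoc)
  then have "dim (range ((*v) X) \<union> range ((*v) Y)) = rank X + rank Y"
    unfolding rank_dim_range by (intro dim_orthogonal_sum) (auto simp: orthogonal_def)
  then show ?thesis
    using dim_subset_UNIV [of "range ((*v) X) \<union> range ((*v) Y)"] by simp
qed

section \<open>Convexity, compactness and the span of the \<open>A i\<close>\<close>

lemma convex_psd: "convex {X :: real^'n^'n. psd X}"
proof (rule convexI, clarsimp)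
  fix X Y :: "real^'n^'n" and u v :: real
  assume "psd X" "psd Y" "0 \<le> u" "0 \<le> v" "u + v = 1"
  then show "psd (u *\<^sub>R X + v *\<^sub>R Y)"
    by (simp add: psd_def sym_matrix_def transpose_def vec_eq_iff matrix_vector_mult_add_rdistrib
        scaleR_matrix_vector_assoc [symmetric] inner_simps)
qed

lemma psd_convex_hull_outer_square:
  assumes "X \<in> convex hull (outer_square ` sphere 0 1)"
  shows "psd X" and "trace X = 1"
proof -
  have "convex {X :: real^'n^'n. trace X = 1}"
    by (rule convexI) (simp add: trace_def sum.distrib sum_distrib_left [symmetric])
  then have "convex hull (outer_square ` sphere 0 1) \<subseteq> {X :: real^'n^'n. psd X} \<inter> {X. trace X = 1}"
    by (intro hull_minimal convex_Int convex_psd)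
      (auto simp: psd_outer_square trace_outer_square norm_eq_1)
  then show "psd X" and "trace X = 1"
    using assms by auto
qed

lemma compact_convex_hull_outer_square:
  "compact (convex hull (outer_square ` sphere (0 :: real^'n) 1))"
  by (intro compact_convex_hull compact_continuous_image)
    (auto simp: outer_square_def intro!: continuous_intros)

lemma subspace_lin_comb: "subspace (range (lin_comb m A))"
  unfolding subspace_def
proof (intro conjI ballI allI)
  have "lin_comb m A (\<lambda>_. 0) = 0"
    by (simp add: lin_comb_def)
  then show "0 \<in> range (lin_comb m A)"
    by (metis rangeI)
next
  fix X Y
  assume "X \<in> range (lin_comb m A)" "Y \<in> range (lin_comb m A)"
  then obtain s t where "X = lin_comb m A s" "Y = lin_comb m A t"
    by blast
  then have "X + Y = lin_comb m A (\<lambda>i. s i + t i)"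
    by (simp add: lin_comb_def scaleR_add_left sum.distrib)
  then show "X + Y \<in> range (lin_comb m A)"
    by blast
next
  fix c X
  assume "X \<in> range (lin_comb m A)"
  then obtain t where "X = lin_comb m A t"
    by blast
  then have "c *\<^sub>R X = lin_comb m A (\<lambda>i. c * t i)"
    by (simp add: lin_comb_def scaleR_sum_right)
  then show "c *\<^sub>R X \<in> range (lin_comb m A)"
    by blast
qed

lemma lin_comb_unit:
  assumes "i \<in> {1..m}"
  shows "lin_comb m A (\<lambda>j. if j = i then 1 else 0) = A i"
  using assms by (simp add: lin_comb_def if_distrib [of "\<lambda>c. c *\<^sub>R _"] cong: if_cong)

lemma sym_lin_comb:
  assumes "\<forall>i\<in>{1..m}. sym_matrix (A i)"
  shows "sym_matrix (lin_comb m A t)"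
  using assms by (simp add: lin_comb_def sym_matrix_def transpose_def vec_eq_iff)

lemma inner_lin_comb_eq_0:
  assumes "\<forall>i\<in>{1..m}. trace_inner (A i) X = 0"
  shows "lin_comb m A t \<bullet> X = 0"
  using assms by (simp add: lin_comb_def inner_sum_left trace_inner_eq_inner)

text \<open>A theorem of the alternative, by strict separation of the subspace
  \<open>L\<^sup>\<bottom>\<close> from the compact set \<open>K\<close>. The normalization
  \<open>trace X = 1\<close> excludes the zero solution.\<close>

lemma solution_or_positive_definite:
  fixes A :: "nat \<Rightarrow> real^'n^'n"
  obtains X where "is_solution m A X" and "trace X = 1"
  | t where "\<And>x. x \<noteq> 0 \<Longrightarrow> 0 < x \<bullet> (lin_comb m A t *v x)"
proof -
  define L K where "L = range (lin_comb m A)"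
    and "K = convex hull (outer_square ` sphere (0 :: real^'n) 1)"
  show thesis
  proof (cases "L\<^sup>\<bottom> \<inter> K = {}")
    case False
    then obtain X where X: "X \<in> L\<^sup>\<bottom>" "X \<in> K"
      by blast
    have "trace_inner (A i) X = 0" if "i \<in> {1..m}" for i
    proof -
      have "A i \<in> L"
        using lin_comb_unit [OF that, of A] unfolding L_def by (metis rangeI)
      then show ?thesis
        using X(1) by (simp add: orthogonal_comp_def orthogonal_def trace_inner_eq_inner)
    qed
    then show thesis
      using that(1) psd_convex_hull_outer_square X(2) unfolding K_def is_solution_def by blast
  next
    case True
    have sub: "subspace (L\<^sup>\<bottom>)"
      by (rule subspace_orthogonal_comp)
    have "K \<noteq> {}"
      by (simp add: K_def)
    then obtain B b where B: "\<forall>X\<in>L\<^sup>\<bottom>. B \<bullet> X < b" "\<forall>X\<in>K. B \<bullet> X > b"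
      using separating_hyperplane_closed_compact [of "L\<^sup>\<bottom>" K] True sub
        compact_convex_hull_outer_square
      unfolding K_def by (metis closed_subspace convex_convex_hull subspace_imp_convex)
    \<comment> \<open>The zero matrix lies in \<open>L\<^sup>\<bottom>\<close>.\<close>
    have b: "0 < b"
      using B(1) subspace_0 [OF sub] by force
    \<comment> \<open>A linear functional bounded above on a subspace vanishes there: otherwise a
      multiple of \<open>X\<close> would attain the excluded value \<open>b\<close>.\<close>
    have "B \<bullet> X = 0" if "X \<in> L\<^sup>\<bottom>" for X
    proof (rule ccontr)
      assume "B \<bullet> X \<noteq> 0"
      moreover have "B \<bullet> ((b / (B \<bullet> X)) *\<^sub>R X) < b"
        using B(1) subspace_mul [OF sub that] by blast
      ultimately show False
        by simp
    qed
    then have "B \<in> L\<^sup>\<bottom>\<^sup>\<bottom>"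
      by (simp add: orthogonal_comp_def [of "L\<^sup>\<bottom>"] orthogonal_def inner_commute)
    then have "B \<in> L"
      using orthogonal_comp_self subspace_lin_comb unfolding L_def by blast
    then obtain t where t: "B = lin_comb m A t"
      unfolding L_def by blast
    have "0 < x \<bullet> (B *v x)" if "x \<noteq> 0" for x
    proof -
      \<comment> \<open>Only unit vectors generate \<open>K\<close>; the bound passes to
        \<open>x\<close> because the form is homogeneous of degree 2.\<close>
      have "outer_square (x /\<^sub>R norm x) \<in> K"
        using that unfolding K_def by (intro hull_inc imageI) simp
      then have "0 < (x /\<^sub>R norm x) \<bullet> (B *v (x /\<^sub>R norm x))"
        using B(2) b inner_outer_square [of B] by fastforce
      also have "\<dots> = x \<bullet> (B *v x) / (norm x)\<^sup>2"
        by (simp add: matrix_vector_mult_scaleR power2_eq_square field_simps)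
      finally show ?thesis
        using that by (simp add: zero_less_divide_iff)
    qed
    then show thesis
      using that(2) t by blast
  qed
qed

lemma positive_definite_rank:
  fixes Y :: "real^'n^'n"
  assumes "\<And>x. x \<noteq> 0 \<Longrightarrow> 0 < x \<bullet> (Y *v x)"
  shows "rank Y = CARD('n)"
proof -
  have "x = 0" if "Y *v x = 0" for x
    using assms [of x] that by force
  then show ?thesis
    by (meson matrix_nonfull_linear_equations_eq)
qed

section \<open>The maximal rank and the solutions\<close>

context
  fixes A :: "nat \<Rightarrow> real^'n^'n" and m :: nat
begin

lemma finite_psd_ranks: "finite {rank (lin_comb m A t) | t. psd (lin_comb m A t)}"
  by (rule finite_subset [of _ "{..CARD('n)}"]) (use rank_bound in fastforce)+

lemma rank_le_max_psd_rank:
  assumes "psd (lin_comb m A t)"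
  shows "rank (lin_comb m A t) \<le> max_psd_rank m A"
  unfolding max_psd_rank_def by (rule Max_ge [OF finite_psd_ranks]) (use assms in blast)

lemma max_psd_rank_attained:
  obtains t where "psd (lin_comb m A t)" and "rank (lin_comb m A t) = max_psd_rank m A"
proof -
  have "psd (lin_comb m A (\<lambda>_. 0))"
    by (simp add: lin_comb_def psd_def sym_matrix_def transpose_def vec_eq_iff)
  then have "max_psd_rank m A \<in> {rank (lin_comb m A t) | t. psd (lin_comb m A t)}"
    unfolding max_psd_rank_def by (intro Max_in finite_psd_ranks) blast
  then show thesis
    using that by auto
qed

text \<open>The additive form avoids truncated subtraction and yields both the rank bound and, for
  nonzero \<open>X\<close>, the necessity of
  \<open>max_psd_rank m A \<le> CARD('n) - 1\<close>.\<close>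

lemma rank_solution_add_max_psd_rank_le:
  assumes "is_solution m A X"
  shows "rank X + max_psd_rank m A \<le> CARD('n)"
proof -
  obtain t where t: "psd (lin_comb m A t)" "rank (lin_comb m A t) = max_psd_rank m A"
    by (rule max_psd_rank_attained)
  have "lin_comb m A t ** X = 0"
    using assms psd_inner_nonneg_and_mult_eq_0 [OF _ t(1)] inner_lin_comb_eq_0
    unfolding is_solution_def by blast
  then show ?thesis
    using rank_add_le_if_mult_eq_0 t by (metis psd_def)
qed

lemma solution_of_trace_1_exists:
  assumes sym: "\<forall>i\<in>{1..m}. sym_matrix (A i)" and "max_psd_rank m A \<le> CARD('n) - 1"
  obtains X where "is_solution m A X" and "trace X = 1"
proof (rule solution_or_positive_definite [of m A])
  fix t
  assume pos: "\<And>x. x \<noteq> 0 \<Longrightarrow> 0 < x \<bullet> (lin_comb m A t *v x)"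
  have "0 \<le> x \<bullet> (lin_comb m A t *v x)" for x
    using pos [of x] by (cases "x = 0") auto
  then have "psd (lin_comb m A t)"
    using sym_lin_comb [OF sym] by (simp add: psd_def)
  then have "CARD('n) \<le> max_psd_rank m A"
    using rank_le_max_psd_rank [of t] positive_definite_rank [of "lin_comb m A t"] pos by simp
  \<comment> \<open>Subtraction on naturals is truncated, so positivity is what makes
    \<open>CARD('n) \<le> CARD('n) - 1\<close> absurd.\<close>
  moreover have "0 < CARD('n)"
    by simp
  ultimately show thesis
    using assms(2) by linarith
qed (use that in blast)

end

theorem corollary3p3:
  fixes A :: "nat \<Rightarrow> real^'n^'n" and m :: nat
  assumes "\<forall>i\<in>{1..m}. sym_matrix (A i)"
  shows "((\<exists>X. is_solution m A X \<and> X \<noteq> 0) \<longleftrightarrow> max_psd_rank m A \<le> CARD('n) - 1)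
     \<and> (\<forall>X. is_solution m A X \<and> X \<noteq> 0 \<longrightarrow> rank X \<le> CARD('n) - max_psd_rank m A)
     \<and> (max_psd_rank m A = CARD('n) - 1 \<longrightarrow>
          (\<exists>X. is_solution m A X \<and> rank X = 1)
        \<and> {X. is_solution m A X \<and> X \<noteq> 0} = {X. is_solution m A X \<and> rank X = 1}
        \<and> equivalent_max_problems (trace_inner (mat 1))
            (rank_constrained_feasible m A) (sdp_feasible m A))"
proof (intro conjI impI allI)
  have card: "0 < CARD('n)"
    by simp
  have rank_pos: "0 < rank X" if "X \<noteq> 0" for X :: "real^'n^'n"
    using that rank_eq_0 [of X] by simp
  have ex_nonzero: "\<exists>X. is_solution m A X \<and> X \<noteq> 0 \<and> trace X = 1"
    if "max_psd_rank m A \<le> CARD('n) - 1"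
    using solution_of_trace_1_exists [OF assms that] by (metis trace_0 mat_0 zero_neq_one)
  show "(\<exists>X. is_solution m A X \<and> X \<noteq> 0) \<longleftrightarrow> max_psd_rank m A \<le> CARD('n) - 1"
    using ex_nonzero rank_solution_add_max_psd_rank_le rank_pos by fastforce
  show "rank X \<le> CARD('n) - max_psd_rank m A" if "is_solution m A X \<and> X \<noteq> 0" for X
    using rank_solution_add_max_psd_rank_le [of m A X] that by simp
  assume eq: "max_psd_rank m A = CARD('n) - 1"
  have rank_le: "rank X \<le> 1" if "is_solution m A X" for X
    using rank_solution_add_max_psd_rank_le [OF that] eq card by linarith
  have rank_1: "rank X = 1 \<longleftrightarrow> X \<noteq> 0" if "is_solution m A X" for X
    using rank_le [OF that] rank_pos [of X] by auto
  obtain X where X: "is_solution m A X" "X \<noteq> 0" "trace X = 1"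
    using ex_nonzero eq by auto
  show "\<exists>X. is_solution m A X \<and> rank X = 1"
    using X rank_1 by blast
  show "{X. is_solution m A X \<and> X \<noteq> 0} = {X. is_solution m A X \<and> rank X = 1}"
    using rank_1 by blast
  \<comment> \<open>Every solution already satisfies the rank constraint.\<close>
  have feasible: "rank_constrained_feasible m A = sdp_feasible m A"
    using rank_le by (auto simp: rank_constrained_feasible_def sdp_feasible_def is_solution_def)
  \<comment> \<open>The objective is the trace, which the constraints bound by 1; the solution
    \<open>X\<close> of trace 1 attains this bound.\<close>
  have "is_max_value (trace_inner (mat 1)) (sdp_feasible m A) 1"
    using X by (auto simp: is_max_value_def trace_inner_mat_1 sdp_feasible_def is_solution_def)
  then show "equivalent_max_problems (trace_inner (mat 1))
      (rank_constrained_feasible m A) (sdp_feasible m A)"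
    unfolding equivalent_max_problems_def feasible by blast
qed

end
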